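(* Fix $\mu\in[1/2,1)$ and $\gamma\in(0,1)$ with $\gamma<\mu$. For each of the three cases below there exist integer-valued functions $k=k(n)$ and $m=m(n)$ of the stated orders of growth such that, for all sufficiently large $n$ with $\gamma n\in\mathbb{N}$, if $|S|=n$ and $\mathcal{A}$ is a family of $m$ different $k$-subsets of $S$ chosen uniformly at random, then with probability $1-O(\exp(-nH(\gamma)))$ the efficiency factor $\eta$ of the custody scheme $(S,\mathcal{A},\mu)$ against a $\gamma$-adversary satisfies: (i) $\eta=\Omega(1)$, with $k=\Theta(1)$ and $m=\Theta(n)$; (ii) $\eta=\Omega(\sqrt n)$, with $k=\Theta(\log n)$ and $m=\Theta(n^2)$; (iii) $\eta=\Omega(n)$, with $k=\Theta(\log n)$ and $m=\Theta(n^3)$. The implied constants (positive in the case of $\Omega$ and $\Theta$) may depend on $\gamma$ and $\mu$ but not on $n$.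
   Context: A custody scheme $(S,\mathcal{A},\mu)$ consists of a set $S$ of $n$ nodes, a family $\mathcal{A}$ of $m$ $k$-subsets of $S$ (called groups), and a threshold $\mu\in[1/2,1)$. For $\gamma\in(0,1)$ with $\gamma n\in\mathbb{N}$ let $$f(\gamma;S,\mathcal{A},\mu):=\max_{B\subseteq S,\ |B|=\gamma n}\big|\{A\in\mathcal{A} : |A\cap B|>\mu k\}\big| .$$ The efficiency factor against a $\gamma$-adversary is $\eta:=\dfrac{\gamma m}{f(\gamma;S,\mathcal{A},\mu)}-1$, with $\eta=+\infty$ if $f=0$. Moreover $H(\gamma):=-\big(\gamma\ln\gamma+(1-\gamma)\ln(1-\gamma)\big)$. *)

theory Defs
  imports "HOL-Probability.Probability" "HOL-Library.Landau_Symbols"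
begin

definition groups :: "'a set \<Rightarrow> nat \<Rightarrow> 'a set set" where
  "groups S k = {A. A \<subseteq> S \<and> card A = k}"

definition families :: "'a set \<Rightarrow> nat \<Rightarrow> nat \<Rightarrow> 'a set set set" where
  "families S k m = {F. F \<subseteq> groups S k \<and> card F = m}"

text \<open>
  The common size \<open>k\<close> of the groups in \<open>F\<close> is passed explicitly. The maximum is only meaningful
  when \<open>S\<close> is finite, \<open>0 \<le> \<gamma> \<le> 1\<close> and \<open>\<gamma> * card S\<close> is a natural number; otherwise no set \<open>B\<close>
  qualifies.
\<close>

definition corrupted :: "real \<Rightarrow> 'a set \<Rightarrow> nat \<Rightarrow> 'a set set \<Rightarrow> real \<Rightarrow> nat" where
  "corrupted \<gamma> S k F \<mu> =
     Max ((\<lambda>B. card {A \<in> F. real (card (A \<inter> B)) > \<mu> * real k}) `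
          {B. B \<subseteq> S \<and> real (card B) = \<gamma> * real (card S)})"

definition efficiency :: "real \<Rightarrow> 'a set \<Rightarrow> nat \<Rightarrow> 'a set set \<Rightarrow> real \<Rightarrow> ereal" where
  "efficiency \<gamma> S k F \<mu> =
     (if corrupted \<gamma> S k F \<mu> = 0 then \<infinity>
      else ereal (\<gamma> * real (card F) / real (corrupted \<gamma> S k F \<mu>) - 1))"

definition entropy_nat :: "real \<Rightarrow> real" where
  "entropy_nat \<gamma> = - (\<gamma> * ln \<gamma> + (1 - \<gamma>) * ln (1 - \<gamma>))"

end

theory Submission
  imports Defs "HOL-Real_Asymp.Real_Asymp"
begin

text \<open>
  For a fixed \<open>B\<close> of size \<open>\<gamma> n\<close>, a random group has more than \<open>\<mu> k\<close> members in \<open>B\<close> with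
  probability at most \<open>q ^ k\<close>, where \<open>q = (1 + y \<gamma>) / (1 + y) powr \<mu> < 1\<close> for small \<open>y > 0\<close> since
  \<open>\<gamma> < \<mu>\<close> (Chernoff bound). A second Chernoff bound, for the random family inside the set of
  all groups, shows that more than \<open>\<tau>\<close> groups are corrupted by \<open>B\<close> with probability at most
  \<open>exp (m z q ^ k) / (1 + z) powr \<tau>\<close>. For \<open>\<tau> = \<gamma> m / (2 g)\<close> at most \<open>\<tau>\<close> corrupted groups
  mean efficiency at least \<open>2 g - 1 \<ge> g\<close>, and \<open>\<tau> \<ge> \<gamma> n / 2\<close> as soon as \<open>n g \<le> m\<close>. So once
  \<open>z\<close> is a large constant and \<open>m z q ^ k \<le> n\<close>, the probability is at most \<open>exp (- 2 n H(\<gamma>))\<close>,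
  which survives a union bound over the at most \<open>exp (n H(\<gamma>))\<close> sets \<open>B\<close>. The three cases are
  \<open>g = 1, sqrt n, n\<close> with \<open>m = n, n\<^sup>2, n\<^sup>3\<close>.
\<close>

section \<open>Intersection of a uniformly random group with a fixed set\<close>

lemma supersets_card:
  assumes "finite S" "T \<subseteq> S" "card T \<le> k"
  shows "card {A \<in> groups S k. T \<subseteq> A} = (card S - card T) choose (k - card T)"
proof -
  have fT: "finite T" using assms finite_subset by blast
  have "bij_betw (\<lambda>A. A - T) {A \<in> groups S k. T \<subseteq> A} (groups (S - T) (k - card T))"
    by (rule bij_betw_byWitness[where f' = "\<lambda>A. A \<union> T"])
      (use assms fT in \<open>auto simp: groups_def card_Diff_subset intro: finite_subset, 
        (subst card_Un_disjoint; auto intro: finite_subset)\<close>)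
  then have "card {A \<in> groups S k. T \<subseteq> A} = card (groups (S - T) (k - card T))"
    by (rule bij_betw_same_card)
  then show ?thesis
    using assms fT by (simp add: groups_def n_subsets card_Diff_subset)
qed

text \<open>Compares the falling factorials factor by factor: \<open>(b - i) / (n - i)\<close> is at
  most \<open>b / n\<close> for \<open>i < b\<close>. This is the point where drawing without
  replacement is dominated by drawing with replacement.\<close>

lemma binomial_ratio_le:
  assumes "b \<le> n"
  shows "real (b choose j) \<le> real (n choose j) * (real b / real n) ^ j"
proof (cases "j \<le> b")
  case True
  have "(\<Prod>i=0..<j. real b - real i) \<le> (\<Prod>i=0..<j. (real n - real i) * (real b / real n))"
  proof (rule prod_mono)
    fix i assume "i \<in> {0..<j}"
    with True have "i < b" by simp
    then have "real b * real n - real i * real n \<le> (real n - real i) * real b"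
      using assms mult_left_mono[of "real b" "real n" "real i"] by (simp add: algebra_simps)
    then show "0 \<le> real b - real i \<and> real b - real i \<le> (real n - real i) * (real b / real n)"
      using \<open>i < b\<close> assms by (simp add: field_simps)
  qed
  also have "\<dots> = (\<Prod>i=0..<j. real n - real i) * (real b / real n) ^ j"
    by (simp only: prod.distrib prod_constant card_atLeastLessThan diff_zero)
  finally show ?thesis
    by (simp add: binomial_gbinomial gbinomial_prod_rev divide_right_mono)
qed (simp add: binomial_eq_0)

lemma sum_Pow_power_card:
  fixes y :: real
  assumes "finite B"
  shows "(\<Sum>T\<in>Pow B. y ^ card T) = (1 + y) ^ card B"
  using assms prod_add[OF assms, of "\<lambda>_. y" "\<lambda>_. 1"] by (simp add: add.commute)

text \<open>By double counting, the left side is also the sum of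
  \<open>card (A \<inter> B) choose j\<close> over all groups \<open>A\<close>, an unnormalised
  binomial moment of the hypergeometric distribution.\<close>

lemma sum_superset_card_groups:
  assumes "finite S" "B \<subseteq> S" "k \<le> card S" "j \<le> k"
  shows "(\<Sum>T\<in>{T\<in>Pow B. card T = j}. card {A \<in> groups S k. T \<subseteq> A}) =
    (card B choose j) * ((card S - j) choose (k - j))"
proof -
  have fB: "finite B" using assms finite_subset by blast
  have "(\<Sum>T\<in>{T\<in>Pow B. card T = j}. card {A \<in> groups S k. T \<subseteq> A}) =
      (\<Sum>T\<in>{T\<in>Pow B. card T = j}. (card S - j) choose (k - j))"
    using assms by (intro sum.cong) (auto simp: supersets_card)
  then show ?thesis
    using n_subsets[OF fB, of j] by simp
qed

text \<open>A bound on the moment generating function of the hypergeometric distribution by that of the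
  binomial distribution, obtained by expanding \<open>(1 + y) ^ card (A \<inter> B)\<close> over the subsets of
  \<open>A \<inter> B\<close>.\<close>

lemma sum_groups_power_card_Int_le:
  fixes y :: real
  assumes "finite S" "B \<subseteq> S" "k \<le> card S" "0 \<le> y"
  shows "(\<Sum>A\<in>groups S k. (1 + y) ^ card (A \<inter> B)) \<le>
    real (card S choose k) * (1 + y * (real (card B) / real (card S))) ^ k"
proof -
  define r where "r = real (card B) / real (card S)"
  have fB: "finite B" using assms finite_subset by blast
  have fG: "finite (groups S k)" using assms by (simp add: groups_def)
  have sub: "card T \<le> k" if "T \<subseteq> A" "A \<in> groups S k" for T A
    using that assms by (metis (mono_tags, lifting) card_mono finite_subset groups_def mem_Collect_eq)
  have empty: "{A\<in>groups S k. T \<subseteq> A} = {}" if "\<not> card T \<le> k" for T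
    using sub that by blast
  have le: "card B \<le> card S" using assms card_mono by blast
  have "(\<Sum>A\<in>groups S k. (1 + y) ^ card (A \<inter> B)) =
      (\<Sum>A\<in>groups S k. \<Sum>T\<in>{T\<in>Pow B. T \<subseteq> A}. y ^ card T)"
  proof (rule sum.cong[OF refl])
    fix A
    have "{T\<in>Pow B. T \<subseteq> A} = Pow (A \<inter> B)" by auto
    then show "(1 + y) ^ card (A \<inter> B) = (\<Sum>T\<in>{T\<in>Pow B. T \<subseteq> A}. y ^ card T)"
      using sum_Pow_power_card[of "A \<inter> B" y] fB by simp
  qed
  also have "\<dots> = (\<Sum>T\<in>Pow B. \<Sum>A\<in>{A\<in>groups S k. T \<subseteq> A}. y ^ card T)"
    using fB fG by (intro sum.swap_restrict) auto
  also have "\<dots> = (\<Sum>T\<in>{T\<in>Pow B. card T \<le> k}. \<Sum>A\<in>{A\<in>groups S k. T \<subseteq> A}. y ^ card T)"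
    using fB by (intro sum.mono_neutral_right) (auto simp: empty)
  also have "\<dots> = (\<Sum>j\<le>k. \<Sum>T\<in>{T\<in>{T\<in>Pow B. card T \<le> k}. card T = j}.
      \<Sum>A\<in>{A\<in>groups S k. T \<subseteq> A}. y ^ card T)"
    using fB by (intro sum.group[symmetric]) auto
  \<comment> \<open>The factor \<open>1 ^ (k - j)\<close> gives the summands the shape of
    \<open>binomial_ring\<close>, which collapses the sum afterwards.\<close>
  also have "\<dots> \<le> (\<Sum>j\<le>k. real (card S choose k) * (real (k choose j) * (y * r) ^ j * 1 ^ (k - j)))"
  proof (rule sum_mono)
    fix j assume "j \<in> {..k}"
    then have j: "j \<le> k" by simp
    have "(\<Sum>T\<in>{T\<in>{T\<in>Pow B. card T \<le> k}. card T = j}.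
        \<Sum>A\<in>{A\<in>groups S k. T \<subseteq> A}. y ^ card T) =
      (\<Sum>T\<in>{T\<in>Pow B. card T = j}. real (card {A\<in>groups S k. T \<subseteq> A}) * y ^ j)"
      using j by (intro sum.cong) auto
    also have "\<dots> = real (card B choose j) * real ((card S - j) choose (k - j)) * y ^ j"
      using sum_superset_card_groups[OF assms(1-3) j]
      by (simp flip: sum_distrib_right of_nat_sum of_nat_mult)
    also have "\<dots> \<le> (real (card S choose j) * r ^ j) * real ((card S - j) choose (k - j)) * y ^ j"
      unfolding r_def using binomial_ratio_le[OF le] assms by (intro mult_right_mono) auto
    also have "\<dots> = real ((card S choose j) * ((card S - j) choose (k - j))) * (y * r) ^ j"
      by (simp add: power_mult_distrib)
    \<comment> \<open>Trading the product for \<open>(card S choose k) * (k choose j)\<close>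
      isolates the number of groups and leaves the coefficients of a \<open>k\<close>-th
      power.\<close>
    also have "\<dots> = real (card S choose k) * (real (k choose j) * (y * r) ^ j * 1 ^ (k - j))"
      using choose_mult[OF j assms(3)] by (simp flip: choose_mult[OF j assms(3)])
    finally show "(\<Sum>T\<in>{T\<in>{T\<in>Pow B. card T \<le> k}. card T = j}.
        \<Sum>A\<in>{A\<in>groups S k. T \<subseteq> A}. y ^ card T) \<le>
      real (card S choose k) * (real (k choose j) * (y * r) ^ j * 1 ^ (k - j))" .
  qed
  also have "\<dots> = real (card S choose k) * (y * r + 1) ^ k"
    by (simp only: binomial_ring sum_distrib_left)
  finally show ?thesis
    by (simp add: r_def add.commute)
qed

text \<open>Markov's inequality for \<open>(1 + y) ^ card (A \<inter> B)\<close>. The element type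
  is arbitrary, so the bound can be applied again to sets whose elements are groups.\<close>

lemma card_groups_Int_gt_le:
  fixes y \<tau> :: real
  assumes "finite S" "B \<subseteq> S" "k \<le> card S" "0 \<le> y"
  shows "real (card {A \<in> groups S k. real (card (A \<inter> B)) > \<tau>}) \<le>
    real (card S choose k) * ((1 + y * (real (card B) / real (card S))) ^ k / (1 + y) powr \<tau>)"
proof -
  let ?X = "{A \<in> groups S k. real (card (A \<inter> B)) > \<tau>}"
  have fG: "finite (groups S k)" using assms by (simp add: groups_def)
  have "real (card ?X) * (1 + y) powr \<tau> = (\<Sum>A\<in>?X. (1 + y) powr \<tau>)"
    by simp
  also have "\<dots> \<le> (\<Sum>A\<in>?X. (1 + y) ^ card (A \<inter> B))"
    using assms by (intro sum_mono) (auto simp flip: powr_realpow intro!: powr_mono)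
  also have "\<dots> \<le> (\<Sum>A\<in>groups S k. (1 + y) ^ card (A \<inter> B))"
    using fG assms by (intro sum_mono2) auto
  also note sum_groups_power_card_Int_le[OF assms]
  finally show ?thesis
    using assms by (simp add: field_simps)
qed

section \<open>Random families and the number of corrupted groups\<close>

text \<open>A family is an \<open>m\<close>-subset of the set of all groups, so every estimate for
  random groups holds one level up.\<close>

lemma families_eq: "families S k m = groups (groups S k) m"
  by (auto simp: families_def groups_def)

lemma card_groups: "finite S \<Longrightarrow> card (groups S k) = card S choose k"
  by (simp add: groups_def n_subsets)

lemma finite_groups: "finite S \<Longrightarrow> finite (groups S k)"
  by (simp add: groups_def)

text \<open>One term of the binomial expansion of \<open>(\<gamma> + (1 - \<gamma>)) ^ n = 1\<close>
  is at most 1, and its weight \<open>\<gamma> ^ b * (1 - \<gamma>) ^ (n - b)\<close> is exactly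
  \<open>exp (- n H(\<gamma>))\<close>.\<close>

lemma binomial_le_exp_entropy:
  assumes "0 < \<gamma>" "\<gamma> < 1" "real b = \<gamma> * real n"
  shows "real (n choose b) \<le> exp (real n * entropy_nat \<gamma>)"
proof -
  have bn: "b \<le> n"
    using assms mult_right_mono[of \<gamma> 1 "real n"] by simp
  have "real (n choose b) * (\<gamma> ^ b * (1 - \<gamma>) ^ (n - b)) \<le>
      (\<Sum>i\<le>n. real (n choose i) * \<gamma> ^ i * (1 - \<gamma>) ^ (n - i))"
    using assms bn member_le_sum[of b "{..n}" "\<lambda>i. real (n choose i) * \<gamma> ^ i * (1 - \<gamma>) ^ (n - i)"]
    by (simp add: mult.assoc)
  also have "\<dots> = 1"
    using binomial_ring[of \<gamma> "1 - \<gamma>" n] by simp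
  finally have "real (n choose b) * (\<gamma> ^ b * (1 - \<gamma>) ^ (n - b)) \<le> 1" .
  moreover have "\<gamma> ^ b * (1 - \<gamma>) ^ (n - b) = exp (real b * ln \<gamma> + real (n - b) * ln (1 - \<gamma>))"
    using assms(1,2) by (simp add: exp_add exp_of_nat_mult)
  moreover have "real b * ln \<gamma> + real (n - b) * ln (1 - \<gamma>) = - (real n * entropy_nat \<gamma>)"
    using assms bn by (simp add: entropy_nat_def of_nat_diff algebra_simps)
  ultimately show ?thesis
    by (simp add: exp_minus field_simps)
qed

text \<open>The tail bound is used twice: for groups it bounds the proportion of the set
  \<open>X\<close> of groups corrupted by \<open>B\<close>; for families it is applied with
  \<open>X\<close> in the role of \<open>B\<close>. The estimate \<open>1 + x \<le> exp x\<close>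
  then gives the exponential.\<close>

lemma card_families_corrupted_le:
  fixes y z \<mu> \<tau> :: real
  assumes "finite S" "B \<subseteq> S" "k \<le> card S" "m \<le> card S choose k" "0 \<le> y" "0 \<le> z"
  shows "real (card {F \<in> families S k m. real (card {A\<in>F. real (card (A \<inter> B)) > \<mu> * real k}) > \<tau>}) \<le>
    real (card (families S k m)) *
    (exp (real m * z * ((1 + y * (real (card B) / real (card S))) / (1 + y) powr \<mu>) ^ k) /
      (1 + z) powr \<tau>)"
proof -
  let ?G = "groups S k"
  let ?p = "((1 + y * (real (card B) / real (card S))) / (1 + y) powr \<mu>) ^ k"
  define X where "X = {A \<in> ?G. real (card (A \<inter> B)) > \<mu> * real k}"
  have p: "?p = (1 + y * (real (card B) / real (card S))) ^ k / (1 + y) powr (\<mu> * real k)"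
    using assms by (simp add: power_divide powr_powr[symmetric] powr_realpow)
  have "0 < card ?G" using assms by (simp add: card_groups)
  then have X: "real (card X) / real (card ?G) \<le> ?p"
    using card_groups_Int_gt_le[OF assms(1-3,5), of "\<mu> * real k"] assms(1)
    unfolding X_def p by (simp add: card_groups field_simps)
  have "{A\<in>F. real (card (A \<inter> B)) > \<mu> * real k} = F \<inter> X" if "F \<in> families S k m" for F
    using that by (auto simp: families_def X_def)
  then have "{F \<in> families S k m. real (card {A\<in>F. real (card (A \<inter> B)) > \<mu> * real k}) > \<tau>} =
      {F \<in> groups ?G m. real (card (F \<inter> X)) > \<tau>}"
    by (auto simp: families_eq)
  also have "real (card \<dots>) \<le> real (card ?G choose m) *
      ((1 + z * (real (card X) / real (card ?G))) ^ m / (1 + z) powr \<tau>)"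
    using assms by (intro card_groups_Int_gt_le) (auto simp: finite_groups card_groups X_def)
  also have "\<dots> \<le> real (card ?G choose m) * (exp (z * ?p) ^ m / (1 + z) powr \<tau>)"
  proof (intro mult_left_mono divide_right_mono power_mono)
    have "1 + z * (real (card X) / real (card ?G)) \<le> 1 + z * ?p"
      using X assms by (intro add_left_mono mult_left_mono)
    also have "\<dots> \<le> exp (z * ?p)" by simp
    finally show "1 + z * (real (card X) / real (card ?G)) \<le> exp (z * ?p)" .
  qed (use assms in auto)
  finally show ?thesis
    using assms by (simp add: families_eq card_groups finite_groups flip: exp_of_nat_mult)
      (simp add: mult_ac)
qed

section \<open>From corruption counts to the efficiency factor\<close>

text \<open>Integrality of \<open>\<gamma> * card S\<close> provides an admissible \<open>B\<close>,
  so the maximum is attained and inherits the bound. The 2 in the denominator pays for the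
  \<open>- 1\<close> in the efficiency: \<open>2 * g - 1 \<ge> g\<close> as
  \<open>1 \<le> g\<close>.\<close>

lemma efficiency_ge:
  assumes "finite S" "0 < \<gamma>" "\<gamma> < 1" "\<gamma> * real (card S) \<in> \<nat>" "1 \<le> g"
    and "\<And>B. B \<subseteq> S \<Longrightarrow> real (card B) = \<gamma> * real (card S) \<Longrightarrow>
      real (card {A \<in> F. real (card (A \<inter> B)) > \<mu> * real k}) \<le> \<gamma> * real (card F) / (2 * g)"
  shows "efficiency \<gamma> S k F \<mu> \<ge> ereal g"
proof (cases "corrupted \<gamma> S k F \<mu> = 0")
  case False
  let ?X = "{B. B \<subseteq> S \<and> real (card B) = \<gamma> * real (card S)}"
  obtain b where b: "real b = \<gamma> * real (card S)"
    using assms(4) by (metis Nats_cases)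
  then have "b \<le> card S"
    using assms mult_right_mono[of \<gamma> 1 "real (card S)"] by simp
  then obtain B0 where "B0 \<subseteq> S" "card B0 = b"
    by (metis obtain_subset_with_card_n)
  with b have "?X \<noteq> {}" by auto
  moreover have "finite ?X" using assms by simp
  ultimately have "corrupted \<gamma> S k F \<mu> \<in> (\<lambda>B. card {A \<in> F. real (card (A \<inter> B)) > \<mu> * real k}) ` ?X"
    unfolding corrupted_def by (intro Max_in) auto
  then have "real (corrupted \<gamma> S k F \<mu>) \<le> \<gamma> * real (card F) / (2 * g)"
    using assms(6) by auto
  then have "2 * g \<le> \<gamma> * real (card F) / real (corrupted \<gamma> S k F \<mu>)"
    using False assms by (simp add: field_simps)
  then show ?thesis
    using False assms by (simp add: efficiency_def)
qed (simp add: efficiency_def)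

text \<open>Nonemptiness is part of the conclusion because \<open>pmf_of_set\<close> is the uniform
  distribution only on nonempty finite sets.\<close>

lemma prob_efficiency_ge:
  fixes y z \<mu> \<gamma> g :: real
  assumes "finite S" "card S = n" "0 < n" "\<gamma> * real n \<in> \<nat>" "0 < \<gamma>" "\<gamma> < 1" "0 \<le> y" "0 \<le> z"
    and k: "k \<le> n" and m: "m \<le> n choose k" and g: "1 \<le> g" "real n * g \<le> real m"
    and z: "2 * entropy_nat \<gamma> + 1 \<le> \<gamma> / 2 * ln (1 + z)"
    and q: "real m * z * ((1 + y * \<gamma>) / (1 + y) powr \<mu>) ^ k \<le> real n"
  shows "families S k m \<noteq> {}"
    and "measure_pmf.prob (pmf_of_set (families S k m)) {F. efficiency \<gamma> S k F \<mu> \<ge> ereal g}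
      \<ge> 1 - exp (- (real n * entropy_nat \<gamma>))"
proof -
  let ?H = "real n * entropy_nat \<gamma>" and ?\<Phi> = "families S k m"
  define \<tau> where "\<tau> = \<gamma> * real m / (2 * g)"
  define bad where "bad B = {F \<in> ?\<Phi>. real (card {A\<in>F. real (card (A \<inter> B)) > \<mu> * real k}) > \<tau>}" for B
  obtain b where b: "real b = \<gamma> * real n"
    using assms(4) by (metis Nats_cases)
  have card\<Phi>: "card ?\<Phi> = (n choose k) choose m"
    using assms by (simp add: families_eq card_groups finite_groups)
  with m have pos: "0 < card ?\<Phi>" by simp
  then show ne: "?\<Phi> \<noteq> {}" by auto
  have fin: "finite ?\<Phi>" using pos card_gt_0_iff by blast
  have \<tau>: "\<gamma> / 2 * real n \<le> \<tau>"
    using g \<open>0 < \<gamma>\<close> mult_left_mono[OF g(2), of \<gamma>] by (simp add: \<tau>_def field_simps)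
  have bad_le: "real (card (bad B)) \<le> real (card ?\<Phi>) * exp (- 2 * ?H)"
    if "B \<in> groups S b" for B
  proof -
    have B: "B \<subseteq> S" "real (card B) = \<gamma> * real n"
      using that b by (auto simp: groups_def)
    have r: "real (card B) / real (card S) = \<gamma>"
      using B assms(2,3) by simp
    have "real (card (bad B)) \<le> real (card ?\<Phi>) *
      (exp (real m * z * ((1 + y * (real (card B) / real (card S))) / (1 + y) powr \<mu>) ^ k) / (1 + z) powr \<tau>)"
      unfolding bad_def using assms B by (intro card_families_corrupted_le) auto
    also have "\<dots> = real (card ?\<Phi>) *
      exp (real m * z * ((1 + y * \<gamma>) / (1 + y) powr \<mu>) ^ k - \<tau> * ln (1 + z))"
      using \<open>0 \<le> z\<close> unfolding r by (simp add: powr_def exp_diff)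
    also have "\<dots> \<le> real (card ?\<Phi>) * exp (- 2 * ?H)"
    proof -
      \<comment> \<open>The extra \<open>+ 1\<close> in the condition on \<open>z\<close> absorbs
        the positive exponent, which is at most \<open>n\<close> by \<open>q\<close>.\<close>
      have "real n * (2 * entropy_nat \<gamma> + 1) \<le> real n * (\<gamma> / 2 * ln (1 + z))"
        using z by (intro mult_left_mono) auto
      also have "\<dots> = \<gamma> / 2 * real n * ln (1 + z)" by simp
      also have "\<dots> \<le> \<tau> * ln (1 + z)"
        using \<tau> \<open>0 \<le> z\<close> by (intro mult_right_mono) auto
      finally have "real m * z * ((1 + y * \<gamma>) / (1 + y) powr \<mu>) ^ k - \<tau> * ln (1 + z) \<le> - 2 * ?H"
        using q by (simp add: algebra_simps)
      then show ?thesis by (intro mult_left_mono) auto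
    qed
    finally show ?thesis .
  qed
  have "real (card (\<Union>B\<in>groups S b. bad B)) \<le> (\<Sum>B\<in>groups S b. real (card (bad B)))"
    using card_UN_le[OF finite_groups[OF assms(1)], of bad b]
    by (metis of_nat_le_iff of_nat_sum)
  also have "\<dots> \<le> (\<Sum>B\<in>groups S b. real (card ?\<Phi>) * exp (- 2 * ?H))"
    using bad_le by (rule sum_mono)
  also have "\<dots> = real (n choose b) * (real (card ?\<Phi>) * exp (- 2 * ?H))"
    using assms by (simp add: card_groups)
  also have "\<dots> \<le> exp ?H * (real (card ?\<Phi>) * exp (- 2 * ?H))"
    using binomial_le_exp_entropy[OF assms(5,6) b] by (intro mult_right_mono) auto
  also have "\<dots> = real (card ?\<Phi>) * exp (- ?H)"
    by (simp add: mult.left_commute flip: exp_add)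
  finally have union: "real (card (\<Union>B\<in>groups S b. bad B)) \<le> real (card ?\<Phi>) * exp (- ?H)" .
  let ?U = "\<Union>B\<in>groups S b. bad B"
  have "efficiency \<gamma> S k F \<mu> \<ge> ereal g" if "F \<in> ?\<Phi> - ?U" for F
  proof (rule efficiency_ge)
    fix B assume B: "B \<subseteq> S" "real (card B) = \<gamma> * real (card S)"
    then have "B \<in> groups S b" using b assms by (simp add: groups_def)
    with that have "F \<in> ?\<Phi>" "F \<notin> bad B" by auto
    then show "real (card {A \<in> F. real (card (A \<inter> B)) > \<mu> * real k}) \<le> \<gamma> * real (card F) / (2 * g)"
      by (auto simp: bad_def \<tau>_def families_def)
  qed (use assms in auto)
  then have "?\<Phi> - ?U \<subseteq> ?\<Phi> \<inter> {F. efficiency \<gamma> S k F \<mu> \<ge> ereal g}" by auto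
  then have "card (?\<Phi> - ?U) \<le> card (?\<Phi> \<inter> {F. efficiency \<gamma> S k F \<mu> \<ge> ereal g})"
    using fin by (intro card_mono) auto
  moreover have "card ?\<Phi> - card ?U \<le> card (?\<Phi> - ?U)"
    by (rule diff_card_le_card_Diff) (use fin in \<open>auto simp: bad_def intro: finite_subset[of _ ?\<Phi>]\<close>)
  ultimately have "real (card ?\<Phi>) * (1 - exp (- ?H)) \<le>
      real (card (?\<Phi> \<inter> {F. efficiency \<gamma> S k F \<mu> \<ge> ereal g}))"
    using union by (simp add: algebra_simps)
  then show "measure_pmf.prob (pmf_of_set ?\<Phi>) {F. efficiency \<gamma> S k F \<mu> \<ge> ereal g} \<ge> 1 - exp (- ?H)"
    using pos by (simp add: measure_pmf_of_set[OF ne fin] field_simps)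
qed

section \<open>Choice of the parameters\<close>

text \<open>The logarithm of the base vanishes at \<open>y = 0\<close> and has derivative
  \<open>\<gamma> - \<mu> < 0\<close> there. An explicit \<open>y\<close> works: with it,
  \<open>\<gamma> * (1 + y)\<close> is the midpoint of \<open>\<gamma>\<close> and
  \<open>\<mu>\<close>.\<close>

lemma exists_tail_base_less_1:
  fixes \<gamma> \<mu> :: real
  assumes "0 < \<gamma>" "\<gamma> < \<mu>"
  obtains y where "0 < y" "(1 + y * \<gamma>) / (1 + y) powr \<mu> < 1"
proof
  let ?y = "(\<mu> - \<gamma>) / (2 * \<gamma>)"
  show y: "0 < ?y" using assms by simp
  have "ln (1 + ?y * \<gamma>) \<le> ?y * \<gamma>"
    using y assms by (intro ln_add_one_self_le_self) auto
  also have "\<dots> < \<mu> * (?y / (1 + ?y))"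
  proof -
    have "\<gamma> * (1 + ?y) < \<mu>" using assms by (simp add: field_simps)
    then have "\<gamma> < \<mu> / (1 + ?y)" using y by (simp add: pos_less_divide_eq)
    then have "?y * \<gamma> < ?y * (\<mu> / (1 + ?y))" using y by (intro mult_strict_left_mono)
    then show ?thesis by (simp add: mult.commute)
  qed
  also have "\<dots> \<le> \<mu> * ln (1 + ?y)"
  proof (intro mult_left_mono)
    \<comment> \<open>A lower bound for \<open>ln (1 + y)\<close> results from the standard upper
      bound at the reciprocal.\<close>
    have "ln (1 / (1 + ?y)) \<le> 1 / (1 + ?y) - 1"
      using y by (intro ln_le_minus_one) auto
    also have "\<dots> = - (?y / (1 + ?y))"
      using y diff_divide_distrib[of 1 "1 + ?y" "1 + ?y"] by simp
    finally show "?y / (1 + ?y) \<le> ln (1 + ?y)" using y by (simp add: ln_div)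
  qed (use assms in simp)
  finally have "1 + ?y * \<gamma> < exp (\<mu> * ln (1 + ?y))"
    using y assms by (metis add_pos_pos exp_less_mono exp_ln mult_pos_pos zero_less_one)
  then show "(1 + ?y * \<gamma>) / (1 + ?y) powr \<mu> < 1"
    using y by (simp add: powr_def)
qed

text \<open>Guarantees enough distinct groups for families of up to \<open>n ^ 3\<close> members.
  Since \<open>n choose k\<close> is at least \<open>(n / k) ^ k\<close>, hence at least
  \<open>sqrt n ^ k\<close>, six factors suffice.\<close>

lemma power3_le_binomial:
  assumes "6 \<le> k" "real k \<le> sqrt (real n)"
  shows "n ^ 3 \<le> n choose k" and "k \<le> n"
proof -
  have "1 \<le> real k" using assms by simp
  then have s: "1 \<le> sqrt (real n)" using assms by linarith
  have "sqrt (real n) * 1 \<le> sqrt (real n) * sqrt (real n)"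
    using s by (intro mult_left_mono) auto
  then have "sqrt (real n) \<le> real n" by simp
  then show kn: "k \<le> n" using assms by linarith
  have "sqrt (real n) * real k \<le> sqrt (real n) * sqrt (real n)"
    using assms by (intro mult_left_mono) auto
  then have quot: "sqrt (real n) \<le> real n / real k"
    using \<open>1 \<le> real k\<close> by (simp add: field_simps)
  have "real n ^ 3 = sqrt (real n) ^ (2 * 3)"
    by (simp only: power_mult) simp
  also have "\<dots> \<le> sqrt (real n) ^ k"
    using s assms by (intro power_increasing) auto
  also have "\<dots> \<le> (real n / real k) ^ k"
    using quot by (intro power_mono) auto
  also have "\<dots> \<le> real (n choose k)"
    using kn by (rule binomial_ge_n_over_k_pow_k)
  finally show "n ^ 3 \<le> n choose k"
    by (metis of_nat_le_iff of_nat_power)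
qed

lemma eventually_prob_efficiency_ge:
  fixes \<gamma> \<mu> y z :: real and g :: "nat \<Rightarrow> real"
  assumes "0 < \<gamma>" "\<gamma> < 1" "0 \<le> y" "0 \<le> z" "2 * entropy_nat \<gamma> + 1 \<le> \<gamma> / 2 * ln (1 + z)"
    and "\<forall>\<^sub>F n in sequentially. 6 \<le> k n" "\<forall>\<^sub>F n in sequentially. real (k n) \<le> sqrt (real n)"
    and "\<forall>\<^sub>F n in sequentially. m n \<le> n ^ 3"
    and "\<forall>\<^sub>F n in sequentially. 1 \<le> g n" "\<forall>\<^sub>F n in sequentially. real n * g n \<le> real (m n)"
    and "\<forall>\<^sub>F n in sequentially. real (m n) * z * ((1 + y * \<gamma>) / (1 + y) powr \<mu>) ^ k n \<le> real n"
  shows "\<exists>c>0. \<exists>C>0. \<forall>\<^sub>F n in sequentially. \<gamma> * real n \<in> \<nat> \<longrightarrow>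
    (\<forall>S :: 'a set. finite S \<and> card S = n \<longrightarrow>
      families S (k n) (m n) \<noteq> {} \<and>
      measure_pmf.prob (pmf_of_set (families S (k n) (m n)))
        {F. efficiency \<gamma> S (k n) F \<mu> \<ge> ereal (c * g n)}
      \<ge> 1 - C * exp (- (real n * entropy_nat \<gamma>)))"
proof -
  \<comment> \<open>The literal factors 1 are the witnesses for \<open>c\<close> and
    \<open>C\<close>.\<close>
  have "\<forall>\<^sub>F n in sequentially. \<gamma> * real n \<in> \<nat> \<longrightarrow>
    (\<forall>S :: 'a set. finite S \<and> card S = n \<longrightarrow>
      families S (k n) (m n) \<noteq> {} \<and>
      measure_pmf.prob (pmf_of_set (families S (k n) (m n)))
        {F. efficiency \<gamma> S (k n) F \<mu> \<ge> ereal (1 * g n)}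
      \<ge> 1 - 1 * exp (- (real n * entropy_nat \<gamma>)))"
    using assms(6-) eventually_gt_at_top[of 0]
  proof eventually_elim
    case (elim n)
    note kn = power3_le_binomial[OF elim(1,2)]
    have mn: "m n \<le> n choose k n" using elim(3) kn(1) by linarith
    show ?case
    proof (intro impI allI)
      fix S :: "'a set"
      assume "\<gamma> * real n \<in> \<nat>" and S: "finite S \<and> card S = n"
      note * = prob_efficiency_ge[OF conjunct1[OF S] conjunct2[OF S] elim(7) this(1) assms(1-4)
          kn(2) mn elim(4,5) assms(5) elim(6)]
      show "families S (k n) (m n) \<noteq> {} \<and>
        measure_pmf.prob (pmf_of_set (families S (k n) (m n)))
          {F. efficiency \<gamma> S (k n) F \<mu> \<ge> ereal (1 * g n)}
        \<ge> 1 - 1 * exp (- (real n * entropy_nat \<gamma>))"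
        using * by simp
    qed
  qed
  then show ?thesis by (meson zero_less_one)
qed

text \<open>The constant \<open>3 / (- ln q)\<close> is chosen so that
  \<open>q ^ k n \<le> 1 / n ^ 3\<close>. This cancels any \<open>m n \<le> n ^ 3\<close> and leaves
  the constant \<open>z\<close>, which \<open>n\<close> eventually exceeds.\<close>

lemma log_size_properties:
  fixes q z :: real
  assumes "0 < q" "q < 1" "0 \<le> z"
  assumes k_def: "k = (\<lambda>n. nat \<lceil>3 / (- ln q) * ln (real n)\<rceil>)"
  shows "(\<lambda>n. real (k n)) \<in> \<Theta>(\<lambda>n. ln (real n))"
    and "\<forall>\<^sub>F n in sequentially. 6 \<le> k n"
    and "\<forall>\<^sub>F n in sequentially. real (k n) \<le> sqrt (real n)"
    and "\<forall>\<^sub>F n in sequentially. m n \<le> n ^ 3 \<Longrightarrow>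
      \<forall>\<^sub>F n in sequentially. real (m n) * z * q ^ k n \<le> real n"
proof -
  define K where "K = 3 / (- ln q)"
  have K: "0 < K" "K * ln q = - 3" using assms by (auto simp: K_def divide_simps)
  have bounds: "\<forall>\<^sub>F n in sequentially. K * ln (real n) \<le> real (k n) \<and> real (k n) \<le> K * ln (real n) + 1"
    using eventually_ge_at_top[of 1]
  proof eventually_elim
    case (elim n)
    then have "0 \<le> K * ln (real n)" using K by simp
    then show ?case unfolding k_def K_def[symmetric] by linarith
  qed
  have one: "\<forall>\<^sub>F n in sequentially. 1 \<le> K * ln (real n)"
    using K by real_asymp
  show "(\<lambda>n. real (k n)) \<in> \<Theta>(\<lambda>n. ln (real n))"
  proof (rule bigthetaI)
    have "\<forall>\<^sub>F n in sequentially. norm (real (k n)) \<le> 2 * K * norm (ln (real n))"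
      using bounds one eventually_ge_at_top[of 1] by eventually_elim simp
    then show "(\<lambda>n. real (k n)) \<in> O(\<lambda>n. ln (real n))"
      by (rule bigoI)
    have "\<forall>\<^sub>F n in sequentially. norm (real (k n)) \<ge> K * norm (ln (real n))"
      using bounds eventually_ge_at_top[of 1] by eventually_elim simp
    with K show "(\<lambda>n. real (k n)) \<in> \<Omega>(\<lambda>n. ln (real n))"
      by (intro landau_omega.bigI[of K])
  qed
  have "\<forall>\<^sub>F n in sequentially. 6 \<le> K * ln (real n)" using K by real_asymp
  with bounds show "\<forall>\<^sub>F n in sequentially. 6 \<le> k n" by eventually_elim linarith
  have "\<forall>\<^sub>F n in sequentially. K * ln (real n) + 1 \<le> sqrt (real n)" using K by real_asymp
  with bounds show "\<forall>\<^sub>F n in sequentially. real (k n) \<le> sqrt (real n)" by eventually_elim linarith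
  show "\<forall>\<^sub>F n in sequentially. real (m n) * z * q ^ k n \<le> real n"
    if "\<forall>\<^sub>F n in sequentially. m n \<le> n ^ 3"
    using bounds that eventually_ge_at_top[of "Suc (nat \<lceil>z\<rceil>)"]
  proof eventually_elim
    case (elim n)
    then have n: "0 < real n" "z \<le> real n" by linarith+
    have "q ^ k n = exp (real (k n) * ln q)"
      using assms by (simp add: exp_of_nat_mult)
    also have "\<dots> \<le> exp (K * ln (real n) * ln q)"
      using elim assms by (simp add: mult_right_mono_neg)
    also have "K * ln (real n) * ln q = - (real 3 * ln (real n))"
      using K by (metis mult.assoc mult.commute mult_minus_left of_nat_numeral)
    also have "exp \<dots> = 1 / real n ^ 3"
      using n by (simp only: exp_minus exp_of_nat_mult exp_ln) (simp add: divide_simps)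
    finally have qk: "q ^ k n \<le> 1 / real n ^ 3" .
    have "real (m n) \<le> real n ^ 3" using elim by (metis of_nat_le_iff of_nat_power)
    then have "real (m n) * z * q ^ k n \<le> real n ^ 3 * z * (1 / real n ^ 3)"
      using qk assms n by (intro mult_mono) auto
    also have "\<dots> = z" using n by simp
    finally show ?case using n by linarith
  qed
qed

section \<open>The three growth regimes\<close>

theorem corollary2:
  fixes \<gamma> \<mu> :: real
  assumes "1/2 \<le> \<mu>" and "\<mu> < 1" and "0 < \<gamma>" and "\<gamma> < 1" and "\<gamma> < \<mu>"
  shows "(\<exists>k m :: nat \<Rightarrow> nat.
            (\<lambda>n. real (k n)) \<in> \<Theta>(\<lambda>n. 1) \<and>
            (\<lambda>n. real (m n)) \<in> \<Theta>(\<lambda>n. real n) \<and>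
            (\<exists>c>0. \<exists>C>0. \<forall>\<^sub>F n in sequentially. \<gamma> * real n \<in> \<nat> \<longrightarrow>
              (\<forall>S :: 'a set. finite S \<and> card S = n \<longrightarrow>
                families S (k n) (m n) \<noteq> {} \<and>
                measure_pmf.prob (pmf_of_set (families S (k n) (m n)))
                  {F. efficiency \<gamma> S (k n) F \<mu> \<ge> ereal (c)}
                \<ge> 1 - C * exp (- (real n * entropy_nat \<gamma>))))) \<and>
         (\<exists>k m :: nat \<Rightarrow> nat.
            (\<lambda>n. real (k n)) \<in> \<Theta>(\<lambda>n. ln (real n)) \<and>
            (\<lambda>n. real (m n)) \<in> \<Theta>(\<lambda>n. real n ^ 2) \<and>
            (\<exists>c>0. \<exists>C>0. \<forall>\<^sub>F n in sequentially. \<gamma> * real n \<in> \<nat> \<longrightarrow>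
              (\<forall>S :: 'a set. finite S \<and> card S = n \<longrightarrow>
                families S (k n) (m n) \<noteq> {} \<and>
                measure_pmf.prob (pmf_of_set (families S (k n) (m n)))
                  {F. efficiency \<gamma> S (k n) F \<mu> \<ge> ereal (c * sqrt (real n))}
                \<ge> 1 - C * exp (- (real n * entropy_nat \<gamma>))))) \<and>
         (\<exists>k m :: nat \<Rightarrow> nat.
            (\<lambda>n. real (k n)) \<in> \<Theta>(\<lambda>n. ln (real n)) \<and>
            (\<lambda>n. real (m n)) \<in> \<Theta>(\<lambda>n. real n ^ 3) \<and>
            (\<exists>c>0. \<exists>C>0. \<forall>\<^sub>F n in sequentially. \<gamma> * real n \<in> \<nat> \<longrightarrow>
              (\<forall>S :: 'a set. finite S \<and> card S = n \<longrightarrow>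
                families S (k n) (m n) \<noteq> {} \<and>
                measure_pmf.prob (pmf_of_set (families S (k n) (m n)))
                  {F. efficiency \<gamma> S (k n) F \<mu> \<ge> ereal (c * real n)}
                \<ge> 1 - C * exp (- (real n * entropy_nat \<gamma>)))))"
proof -
  obtain y where y: "0 < y" "(1 + y * \<gamma>) / (1 + y) powr \<mu> < 1"
    using exists_tail_base_less_1 assms by blast
  define q where "q = (1 + y * \<gamma>) / (1 + y) powr \<mu>"
  \<comment> \<open>Solves the condition on \<open>ln (1 + z)\<close> for \<open>z\<close>; the
    \<open>max 0\<close> secures \<open>0 \<le> z\<close>.\<close>
  define z where "z = exp (max 0 ((2 * entropy_nat \<gamma> + 1) / (\<gamma> / 2))) - 1"
  have z: "0 \<le> z" "2 * entropy_nat \<gamma> + 1 \<le> \<gamma> / 2 * ln (1 + z)"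
  proof -
    have "(2 * entropy_nat \<gamma> + 1) / (\<gamma> / 2) \<le> ln (1 + z)" by (simp add: z_def)
    then show "2 * entropy_nat \<gamma> + 1 \<le> \<gamma> / 2 * ln (1 + z)"
      using assms by (simp add: field_simps)
  qed (simp add: z_def)
  have q: "0 < q" "q < 1"
    using y assms by (auto simp: q_def intro!: divide_pos_pos add_pos_pos)
  \<comment> \<open>For \<open>m = n\<close> the exponent condition reads
    \<open>n * z * q ^ k \<le> n\<close>, so a constant group size \<open>k0\<close> is enough;
    \<open>6 \<le> k0\<close> serves the binomial bound.\<close>
  have "(\<lambda>i. z * q ^ i) \<longlonglongrightarrow> 0"
    using q by (intro tendsto_mult_right_zero LIMSEQ_power_zero) auto
  then have "\<forall>\<^sub>F i in sequentially. z * q ^ i < 1"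
    by (rule order_tendstoD) simp
  then have "\<forall>\<^sub>F i in sequentially. z * q ^ i < 1 \<and> 6 \<le> i"
    by (intro eventually_conj eventually_ge_at_top)
  then obtain k0 where k0: "z * q ^ k0 < 1" "6 \<le> k0"
    using eventually_happens by fastforce
  define k where "k = (\<lambda>n. nat \<lceil>3 / (- ln q) * ln (real n)\<rceil>)"
  note k = log_size_properties[OF q z(1) k_def]
  note efficient = eventually_prob_efficiency_ge[OF assms(3,4) less_imp_le[OF y(1)] z,
      where \<mu> = \<mu>, folded q_def]
  have n3: "\<forall>\<^sub>F n in sequentially. n ^ j \<le> n ^ 3" if "j \<le> 3" for j :: nat
    using eventually_ge_at_top[of "1::nat"]
    by eventually_elim (use that in \<open>auto intro: power_increasing\<close>)
  show ?thesis
  proof (intro conjI)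
    have "\<forall>\<^sub>F n in sequentially. real k0 \<le> sqrt (real n)"
      by real_asymp
    then show "\<exists>k m :: nat \<Rightarrow> nat.
            (\<lambda>n. real (k n)) \<in> \<Theta>(\<lambda>n. 1) \<and>
            (\<lambda>n. real (m n)) \<in> \<Theta>(\<lambda>n. real n) \<and>
            (\<exists>c>0. \<exists>C>0. \<forall>\<^sub>F n in sequentially. \<gamma> * real n \<in> \<nat> \<longrightarrow>
              (\<forall>S :: 'a set. finite S \<and> card S = n \<longrightarrow>
                families S (k n) (m n) \<noteq> {} \<and>
                measure_pmf.prob (pmf_of_set (families S (k n) (m n)))
                  {F. efficiency \<gamma> S (k n) F \<mu> \<ge> ereal (c)}
                \<ge> 1 - C * exp (- (real n * entropy_nat \<gamma>))))"
      using k0 n3[of 1] efficient[of "\<lambda>_. k0" "\<lambda>n. n" "\<lambda>_. 1"]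
        mult_left_mono[OF less_imp_le[OF k0(1)], of "real n" for n]
      by (intro exI[of _ "\<lambda>_. k0"] exI[of _ "\<lambda>n. n"] conjI) (auto simp: mult.assoc)
  next
    \<comment> \<open>The conditions \<open>1 \<le> g\<close> and \<open>n * g \<le> m\<close> for
      \<open>g = sqrt n\<close>, \<open>m = n ^ 2\<close>; the second compares \<open>n\<close> to
      the power 3/2 with \<open>n ^ 2\<close>.\<close>
    have "\<forall>\<^sub>F n in sequentially. 1 \<le> sqrt (real n)"
      and "\<forall>\<^sub>F n in sequentially. real n * sqrt (real n) \<le> real (n ^ 2)"
      by (real_asymp, simp, real_asymp)
    then show "\<exists>k m :: nat \<Rightarrow> nat.
            (\<lambda>n. real (k n)) \<in> \<Theta>(\<lambda>n. ln (real n)) \<and>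
            (\<lambda>n. real (m n)) \<in> \<Theta>(\<lambda>n. real n ^ 2) \<and>
            (\<exists>c>0. \<exists>C>0. \<forall>\<^sub>F n in sequentially. \<gamma> * real n \<in> \<nat> \<longrightarrow>
              (\<forall>S :: 'a set. finite S \<and> card S = n \<longrightarrow>
                families S (k n) (m n) \<noteq> {} \<and>
                measure_pmf.prob (pmf_of_set (families S (k n) (m n)))
                  {F. efficiency \<gamma> S (k n) F \<mu> \<ge> ereal (c * sqrt (real n))}
                \<ge> 1 - C * exp (- (real n * entropy_nat \<gamma>))))"
      using efficient[OF k(2,3) n3[of 2] _ _ k(4)[OF n3[of 2]], of "\<lambda>n. sqrt (real n)"] k(1)
      by (intro exI[of _ k] exI[of _ "\<lambda>n. n ^ 2"] conjI) simp_all
  next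
    have "\<forall>\<^sub>F n in sequentially. 1 \<le> real n"
      and "\<forall>\<^sub>F n in sequentially. real n * real n \<le> real (n ^ 3)"
      by (real_asymp, simp, real_asymp)
    then show "\<exists>k m :: nat \<Rightarrow> nat.
            (\<lambda>n. real (k n)) \<in> \<Theta>(\<lambda>n. ln (real n)) \<and>
            (\<lambda>n. real (m n)) \<in> \<Theta>(\<lambda>n. real n ^ 3) \<and>
            (\<exists>c>0. \<exists>C>0. \<forall>\<^sub>F n in sequentially. \<gamma> * real n \<in> \<nat> \<longrightarrow>
              (\<forall>S :: 'a set. finite S \<and> card S = n \<longrightarrow>
                families S (k n) (m n) \<noteq> {} \<and>
                measure_pmf.prob (pmf_of_set (families S (k n) (m n)))
                  {F. efficiency \<gamma> S (k n) F \<mu> \<ge> ereal (c * real n)}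
                \<ge> 1 - C * exp (- (real n * entropy_nat \<gamma>))))"
      using efficient[OF k(2,3) n3[of 3] _ _ k(4)[OF n3[of 3]], of "\<lambda>n. real n"] k(1)
      by (intro exI[of _ k] exI[of _ "\<lambda>n. n ^ 3"] conjI) simp_all
  qed
qed

end
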